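(* Let $\mathcal{H}$ be a Hilbert space and let $\mathcal{U}\subseteq B(\mathcal{H})$ be a closed unital subspace that has the trivial intersection property. Then $C^*_e(\mathcal{U})\cong C^*(\mathcal{U})$.
   Context: $B(\mathcal{H})$ is the space of bounded linear operators on $\mathcal{H}$. All subspaces are assumed norm-closed; a subspace of $B(\mathcal{H})$ is unital if it contains the identity operator $I$. $C^*(\mathcal{U})$ is the $C^*$-subalgebra of $B(\mathcal{H})$ generated by $\mathcal{U}$, and $\cong$ denotes $*$-isomorphism of $C^*$-algebras. Trivial intersection property: a closed subspace $\mathcal{U}\subseteq B(\mathcal{H})$ has it if for every closed two-sided ideal $J$ of $C^*(\mathcal{U})$, $\mathcal{U}\cap J=\{0\}$ implies $J=\{0\}$. $C^*$-envelope: a closed two-sided ideal $J$ of $C^*(\mathcal{U})$ is a boundary ideal for $\mathcal{U}$ if the restriction to $\mathcal{U}$ of the quotient map $C^*(\mathcal{U})\to C^*(\mathcal{U})/J$ is a complete isometry. For unital $\mathcal{U}$ there is a largest boundary ideal $J$ (the Shilov boundary of $\mathcal{U}$), and the $C^*$-envelope $C^*_e(\mathcal{U})$ is (up to $*$-isomorphism) $C^*(\mathcal{U})/J$ for this largest $J$. *)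

theory Defs
  imports "HOL-Analysis.Analysis" "HOL-Library.Set_Algebras"
begin

section \<open>Complex Hilbert spaces\<close>

text \<open>The inner product is linear in the first argument and conjugate-linear in the second.
  The underlying real normed space provides the topology, so that the library's bounded linear
  maps and their operator norm are available.\<close>

class complex_hilbert = banach +
  fixes scaleC :: "complex \<Rightarrow> 'a \<Rightarrow> 'a" (infixr \<open>*\<^sub>C\<close> 75)
    and cinner :: "'a \<Rightarrow> 'a \<Rightarrow> complex"
  assumes scaleC_add_right: "c *\<^sub>C (x + y) = c *\<^sub>C x + c *\<^sub>C y"
    and scaleC_add_left: "(c + d) *\<^sub>C x = c *\<^sub>C x + d *\<^sub>C x"
    and scaleC_scaleC: "c *\<^sub>C (d *\<^sub>C x) = (c * d) *\<^sub>C x"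
    and scaleC_of_real: "complex_of_real r *\<^sub>C x = r *\<^sub>R x"
    and cinner_commute: "cinner x y = cnj (cinner y x)"
    and cinner_add_left: "cinner (x + y) z = cinner x z + cinner y z"
    and cinner_scaleC_left: "cinner (c *\<^sub>C x) y = c * cinner x y"
    and cinner_self: "cinner x x = complex_of_real ((norm x)\<^sup>2)"

instantiation complex :: complex_hilbert
begin

definition scaleC_complex :: "complex \<Rightarrow> complex \<Rightarrow> complex"
  where "scaleC_complex c x = c * x"

definition cinner_complex :: "complex \<Rightarrow> complex \<Rightarrow> complex"
  where "cinner_complex x y = x * cnj y"

instance
  by standard (simp_all add: scaleC_complex_def cinner_complex_def algebra_simps scaleR_conv_of_real
      complex_norm_square[symmetric] del: of_real_power)

end

lemma norm_scaleC: "norm (c *\<^sub>C x) = cmod c * norm (x :: 'a::complex_hilbert)"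
proof -
  have "complex_of_real ((norm (c *\<^sub>C x))\<^sup>2) = cinner (c *\<^sub>C x) (c *\<^sub>C x)"
    by (simp only: cinner_self)
  also have "\<dots> = c * cnj (c * cinner x x)"
    by (metis cinner_scaleC_left cinner_commute)
  also have "\<dots> = (c * cnj c) * complex_of_real ((norm x)\<^sup>2)"
    by (simp add: cinner_self)
  also have "\<dots> = complex_of_real ((cmod c * norm x)\<^sup>2)"
    by (simp add: complex_norm_square[symmetric] power_mult_distrib)
  finally have "(norm (c *\<^sub>C x))\<^sup>2 = (cmod c * norm x)\<^sup>2"
    by (simp only: of_real_eq_iff)
  then show ?thesis
    by (simp add: power2_eq_iff_nonneg)
qed

lemma bounded_linear_scaleC: "bounded_linear (\<lambda>x :: 'a::complex_hilbert. c *\<^sub>C x)"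
proof (rule bounded_linear_intro[where K = "cmod c"])
  fix r :: real and x :: 'a
  have "c *\<^sub>C (complex_of_real r *\<^sub>C x) = complex_of_real r *\<^sub>C (c *\<^sub>C x)"
    by (simp only: scaleC_scaleC mult.commute)
  then show "c *\<^sub>C (r *\<^sub>R x) = r *\<^sub>R (c *\<^sub>C x)"
    by (simp only: scaleC_of_real)
qed (simp_all add: scaleC_add_right norm_scaleC mult.commute)


section \<open>Bounded operators\<close>

text \<open>The type of library operators consists of the real-linear bounded maps, carrying the operator
  norm; B(H) is the closed subset of the complex-linear ones.\<close>

type_synonym 'h operator = "'h \<Rightarrow>\<^sub>L 'h"

definition bounded_ops :: "'h::complex_hilbert operator set"
  where "bounded_ops = {T. \<forall>c x. blinfun_apply T (c *\<^sub>C x) = c *\<^sub>C blinfun_apply T x}"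

lift_definition scale_op :: "complex \<Rightarrow> 'h::complex_hilbert operator \<Rightarrow> 'h operator"
  is "\<lambda>c T x. c *\<^sub>C T x"
  by (rule bounded_linear_compose[OF bounded_linear_scaleC])

definition adjoint_op :: "'h::complex_hilbert operator \<Rightarrow> 'h operator"
  where "adjoint_op T = (THE S. S \<in> bounded_ops \<and>
    (\<forall>x y. cinner (blinfun_apply S x) y = cinner x (blinfun_apply T y)))"

definition closed_op_subspace :: "'h::complex_hilbert operator set \<Rightarrow> bool"
  where "closed_op_subspace U \<longleftrightarrow> U \<subseteq> bounded_ops \<and> closed U \<and> 0 \<in> U \<and>
    (\<forall>S\<in>U. \<forall>T\<in>U. S + T \<in> U) \<and> (\<forall>c. \<forall>T\<in>U. scale_op c T \<in> U)"

definition unital_subspace :: "'h::complex_hilbert operator set \<Rightarrow> bool"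
  where "unital_subspace U \<longleftrightarrow> id_blinfun \<in> U"

text \<open>The operator norm of an \<open>n \<times> n\<close> matrix of operators acting on the \<open>n\<close>-fold Hilbert sum of
  the space with itself. Only the entries with both indices below \<open>n\<close> matter.\<close>

definition op_matrix_norm :: "nat \<Rightarrow> (nat \<Rightarrow> nat \<Rightarrow> 'h::complex_hilbert operator) \<Rightarrow> real"
  where "op_matrix_norm n T =
    Sup {sqrt (\<Sum>i<n. (norm (\<Sum>j<n. blinfun_apply (T i j) (x j)))\<^sup>2) | x :: nat \<Rightarrow> 'h.
           (\<Sum>j<n. (norm (x j))\<^sup>2) \<le> 1}"


section \<open>Generated C*-algebras, ideals and quotients\<close>

definition cstar_subalgebra :: "'h::complex_hilbert operator set \<Rightarrow> bool"
  where "cstar_subalgebra A \<longleftrightarrow> closed_op_subspace A \<and>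
    (\<forall>S\<in>A. \<forall>T\<in>A. S o\<^sub>L T \<in> A) \<and> (\<forall>T\<in>A. adjoint_op T \<in> A)"

definition cstar_gen :: "'h::complex_hilbert operator set \<Rightarrow> 'h operator set"
  where "cstar_gen U = \<Inter>{A. cstar_subalgebra A \<and> U \<subseteq> A}"

definition closed_ideal :: "'h::complex_hilbert operator set \<Rightarrow> 'h operator set \<Rightarrow> bool"
  where "closed_ideal A J \<longleftrightarrow> closed_op_subspace J \<and> J \<subseteq> A \<and>
    (\<forall>a\<in>A. \<forall>b\<in>J. a o\<^sub>L b \<in> J \<and> b o\<^sub>L a \<in> J)"

text \<open>The *-algebra data of a C*-algebra; the C*-norm is determined by them.\<close>

record 'a star_alg =
  carrier :: "'a set"
  add :: "'a \<Rightarrow> 'a \<Rightarrow> 'a"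
  mult :: "'a \<Rightarrow> 'a \<Rightarrow> 'a"
  scale :: "complex \<Rightarrow> 'a \<Rightarrow> 'a"
  star :: "'a \<Rightarrow> 'a"

definition star_isomorphism :: "'a star_alg \<Rightarrow> 'b star_alg \<Rightarrow> ('a \<Rightarrow> 'b) \<Rightarrow> bool"
  where "star_isomorphism A B \<phi> \<longleftrightarrow> bij_betw \<phi> (carrier A) (carrier B) \<and>
    (\<forall>x\<in>carrier A. \<forall>y\<in>carrier A. \<phi> (add A x y) = add B (\<phi> x) (\<phi> y)) \<and>
    (\<forall>x\<in>carrier A. \<forall>y\<in>carrier A. \<phi> (mult A x y) = mult B (\<phi> x) (\<phi> y)) \<and>
    (\<forall>c. \<forall>x\<in>carrier A. \<phi> (scale A c x) = scale B c (\<phi> x)) \<and>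
    (\<forall>x\<in>carrier A. \<phi> (star A x) = star B (\<phi> x))"

definition star_isomorphic :: "'a star_alg \<Rightarrow> 'b star_alg \<Rightarrow> bool" (infix \<open>\<cong>\<^sub>*\<close> 50)
  where "A \<cong>\<^sub>* B \<longleftrightarrow> (\<exists>\<phi>. star_isomorphism A B \<phi>)"

definition op_alg :: "'h::complex_hilbert operator set \<Rightarrow> 'h operator star_alg"
  where "op_alg A = \<lparr>carrier = A, add = (+), mult = (o\<^sub>L), scale = scale_op, star = adjoint_op\<rparr>"

definition quotient_map :: "'h::complex_hilbert operator set \<Rightarrow> 'h operator \<Rightarrow> 'h operator set"
  where "quotient_map J a = a +o J"

text \<open>Elements of the quotient are cosets. Products and scalar multiples are taken over all
  representatives and thickened by \<open>J\<close>, as the bare set product, or \<open>0\<close> times a coset, need not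
  be a full coset.\<close>

definition quotient_alg ::
    "'h::complex_hilbert operator set \<Rightarrow> 'h operator set \<Rightarrow> 'h operator set star_alg"
  where "quotient_alg A J =
    \<lparr>carrier = quotient_map J ` A,
     add = (\<lambda>X Y. X + Y),
     mult = (\<lambda>X Y. \<Union>x\<in>X. \<Union>y\<in>Y. quotient_map J (x o\<^sub>L y)),
     scale = (\<lambda>c X. \<Union>x\<in>X. quotient_map J (scale_op c x)),
     star = (\<lambda>X. adjoint_op ` X)\<rparr>"

text \<open>The norm on \<open>n \<times> n\<close> matrices over \<open>A/J\<close> under the identification of \<open>M\<^sub>n(A/J)\<close> with
  \<open>M\<^sub>n(A)/M\<^sub>n(J)\<close>: the infimum of the norms of all matrices lifting the given matrix of cosets.\<close>

definition quotient_matrix_norm :: "nat \<Rightarrow> (nat \<Rightarrow> nat \<Rightarrow> 'h::complex_hilbert operator set) \<Rightarrow> real"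
  where "quotient_matrix_norm n X = Inf {op_matrix_norm n a | a. \<forall>i<n. \<forall>j<n. a i j \<in> X i j}"

definition complete_isometry_on ::
    "'a set \<Rightarrow> (nat \<Rightarrow> (nat \<Rightarrow> nat \<Rightarrow> 'a) \<Rightarrow> real) \<Rightarrow> (nat \<Rightarrow> (nat \<Rightarrow> nat \<Rightarrow> 'b) \<Rightarrow> real) \<Rightarrow>
      ('a \<Rightarrow> 'b) \<Rightarrow> bool"
  where "complete_isometry_on U N N' \<phi> \<longleftrightarrow>
    (\<forall>n\<ge>1. \<forall>u. (\<forall>i<n. \<forall>j<n. u i j \<in> U) \<longrightarrow> N' n (\<lambda>i j. \<phi> (u i j)) = N n u)"


section \<open>The trivial intersection property and the C*-envelope\<close>

definition trivial_intersection_property :: "'h::complex_hilbert operator set \<Rightarrow> bool"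
  where "trivial_intersection_property U \<longleftrightarrow>
    (\<forall>J. closed_ideal (cstar_gen U) J \<longrightarrow> U \<inter> J = {0} \<longrightarrow> J = {0})"

definition boundary_ideal :: "'h::complex_hilbert operator set \<Rightarrow> 'h operator set \<Rightarrow> bool"
  where "boundary_ideal U J \<longleftrightarrow> closed_ideal (cstar_gen U) J \<and>
    complete_isometry_on U op_matrix_norm quotient_matrix_norm (quotient_map J)"

text \<open>\<open>GREATEST\<close> with respect to inclusion: the boundary ideal that contains every boundary ideal.\<close>

definition shilov_boundary :: "'h::complex_hilbert operator set \<Rightarrow> 'h operator set"
  where "shilov_boundary U = (GREATEST J. boundary_ideal U J)"

definition cstar_envelope :: "'h::complex_hilbert operator set \<Rightarrow> 'h operator set star_alg"
  where "cstar_envelope U = quotient_alg (cstar_gen U) (shilov_boundary U)"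

end

theory Submission
  imports Defs
begin

text \<open>The trivial intersection property leaves no room for a nonzero boundary ideal. If \<open>J\<close> is a
  boundary ideal and \<open>u\<close> lies in both \<open>U\<close> and \<open>J\<close>, then \<open>u\<close> vanishes in the quotient, and since
  the quotient map is isometric on \<open>U\<close> already at the level of \<open>1 \<times> 1\<close> matrices, \<open>u = 0\<close>
  (\<open>boundary_ideal_Int_eq_0\<close>). Hence \<open>J\<close> meets \<open>U\<close> trivially and must be zero. Conversely the
  zero ideal is a boundary ideal, as its quotient map changes nothing
  (\<open>boundary_ideal_zero\<close>). So the Shilov boundary is zero, and the envelope is the quotient of
  the generated C*-algebra by the zero ideal, whose cosets are singletons
  (\<open>quotient_alg_zero_isomorphic\<close>).\<close>

lemma op_matrix_norm_1: "op_matrix_norm 1 T = norm (T 0 0)"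
proof -
  let ?S = "{norm (blinfun_apply (T 0 0) x) | x. norm x \<le> 1}"
  have "{sqrt (\<Sum>i<1. (norm (\<Sum>j<1. blinfun_apply (T i j) (x j)))\<^sup>2) | x :: nat \<Rightarrow> 'a.
      (\<Sum>j<1. (norm (x j))\<^sup>2) \<le> 1} =
      {norm (blinfun_apply (T 0 0) (x 0)) | x :: nat \<Rightarrow> 'a. norm (x 0) \<le> 1}"
    by (simp add: power_le_one_iff abs_square_le_1)
  also have "\<dots> = ?S"
  proof (intro set_eqI iffI)
    fix r assume "r \<in> ?S"
    then obtain y where "r = norm (blinfun_apply (T 0 0) y)" "norm y \<le> 1" by blast
    then show "r \<in> {norm (blinfun_apply (T 0 0) (x 0)) | x :: nat \<Rightarrow> 'a. norm (x 0) \<le> 1}"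
      by (auto intro!: exI[of _ "\<lambda>_. y"])
  qed blast
  finally have eq: "op_matrix_norm 1 T = Sup ?S"
    by (simp add: op_matrix_norm_def)
  have le: "norm (blinfun_apply (T 0 0) x) \<le> norm (T 0 0)" if "norm x \<le> 1" for x
    using norm_blinfun[of "T 0 0" x] mult_left_mono[OF that, of "norm (T 0 0)"] by simp
  have upper: "norm (blinfun_apply (T 0 0) x) \<le> Sup ?S" if "norm x \<le> 1" for x
    by (rule cSup_upper) (use that le in \<open>auto intro!: bdd_aboveI[where M = "norm (T 0 0)"]\<close>)
  have "Sup ?S \<le> norm (T 0 0)"
    by (rule cSup_least) (auto intro: le exI[of _ 0])
  moreover have "norm (T 0 0) \<le> Sup ?S"
  proof (rule norm_blinfun_bound)
    show "0 \<le> Sup ?S"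
      using upper[of 0] by simp
    show "norm (blinfun_apply (T 0 0) x) \<le> Sup ?S * norm x" for x
    proof (cases "x = 0")
      case False
      then show ?thesis
        using upper[of "x /\<^sub>R norm x"] by (simp add: blinfun.scaleR_right field_simps)
    qed simp
  qed
  ultimately show ?thesis
    using eq by simp
qed

lemma op_matrix_norm_cong:
  assumes "\<And>i j. i < n \<Longrightarrow> j < n \<Longrightarrow> S i j = T i j"
  shows "op_matrix_norm n S = op_matrix_norm n T"
proof -
  have "(\<Sum>i<n. (norm (\<Sum>j<n. blinfun_apply (S i j) (x j)))\<^sup>2) =
      (\<Sum>i<n. (norm (\<Sum>j<n. blinfun_apply (T i j) (x j)))\<^sup>2)" for x
    by (simp add: assms)
  then show ?thesis
    by (simp add: op_matrix_norm_def)
qed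

lemma quotient_map_zero: "quotient_map {0} a = {a}"
  by (simp add: quotient_map_def elt_set_plus_def)

text \<open>A coset of an element of the ideal contains the zero operator, so its quotient norm is zero.\<close>

lemma quotient_matrix_norm_1_eq_0:
  assumes "closed_op_subspace J" and "u \<in> J"
  shows "quotient_matrix_norm 1 (\<lambda>i j. quotient_map J u) = 0"
proof -
  have "scale_op (-1) u = - u"
  proof (rule blinfun_eqI)
    show "blinfun_apply (scale_op (-1) u) x = blinfun_apply (- u) x" for x
      using scaleC_of_real[of "-1" "blinfun_apply u x"]
      by (simp add: scale_op.rep_eq blinfun.minus_left)
  qed
  then have "- u \<in> J"
    using assms by (metis closed_op_subspace_def)
  then have "0 \<in> quotient_map J u"
    by (force simp: quotient_map_def elt_set_plus_def)
  then have "(0::real) \<in> {op_matrix_norm 1 a | a. \<forall>i<1. \<forall>j<1. a i j \<in> quotient_map J u}"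
    by (intro CollectI exI[of _ "\<lambda>_ _. 0"] conjI) (simp_all only: op_matrix_norm_1 norm_zero, simp)
  moreover have "0 \<le> r"
    if "r \<in> {op_matrix_norm 1 a | a. \<forall>i<1. \<forall>j<1. a i j \<in> quotient_map J u}" for r
    using that by (auto simp only: op_matrix_norm_1 mem_Collect_eq norm_ge_zero)
  ultimately show ?thesis
    unfolding quotient_matrix_norm_def by (rule cInf_eq_minimum)
qed

lemma boundary_ideal_Int_eq_0:
  assumes "closed_op_subspace U" and "boundary_ideal U J"
  shows "U \<inter> J = {0}"
proof -
  have J: "closed_op_subspace J"
    and iso: "complete_isometry_on U op_matrix_norm quotient_matrix_norm (quotient_map J)"
    using assms(2) by (auto simp: boundary_ideal_def closed_ideal_def)
  have "u = 0" if "u \<in> U" "u \<in> J" for u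
  proof -
    have "quotient_matrix_norm 1 (\<lambda>i j. quotient_map J u) = op_matrix_norm 1 (\<lambda>i j. u)"
      using iso that(1) unfolding complete_isometry_on_def by (elim allE[of _ 1]) simp
    then show "u = 0"
      by (simp only: quotient_matrix_norm_1_eq_0[OF J that(2)] op_matrix_norm_1) simp
  qed
  moreover have "0 \<in> U" "0 \<in> J"
    using assms(1) J by (auto simp: closed_op_subspace_def)
  ultimately show ?thesis
    by blast
qed

lemma closed_op_subspace_zero: "closed_op_subspace {0 :: 'h::complex_hilbert operator}"
proof -
  have scaleC_0: "c *\<^sub>C 0 = (0 :: 'h)" for c
    using norm_scaleC[of c "0 :: 'h"] by simp
  have "scale_op c 0 = (0 :: 'h operator)" for c
    by (rule blinfun_eqI) (simp add: scale_op.rep_eq scaleC_0)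
  then show ?thesis
    by (simp add: closed_op_subspace_def bounded_ops_def scaleC_0)
qed

lemma boundary_ideal_zero:
  assumes "closed_op_subspace U"
  shows "boundary_ideal U {0}"
proof -
  have "0 \<in> cstar_gen U"
    using assms by (auto simp: cstar_gen_def closed_op_subspace_def)
  then have "closed_ideal (cstar_gen U) {0}"
    by (simp add: closed_ideal_def closed_op_subspace_zero)
  moreover have "quotient_matrix_norm n (\<lambda>i j. quotient_map {0} (u i j)) = op_matrix_norm n u"
    for n and u :: "nat \<Rightarrow> nat \<Rightarrow> 'a operator"
  proof -
    \<comment> \<open>The lifts of \<open>u\<close> are the matrices that agree with \<open>u\<close> on the relevant indices, but they
      are arbitrary elsewhere.\<close>
    have "{op_matrix_norm n a | a. \<forall>i<n. \<forall>j<n. a i j \<in> quotient_map {0} (u i j)} =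
        {op_matrix_norm n u}"
      by (auto simp: quotient_map_zero intro: op_matrix_norm_cong)
    then show ?thesis
      by (simp add: quotient_matrix_norm_def)
  qed
  ultimately show ?thesis
    by (simp add: boundary_ideal_def complete_isometry_on_def)
qed

lemma shilov_boundary_eq_zero:
  assumes "closed_op_subspace U" and "trivial_intersection_property U"
  shows "shilov_boundary U = {0}"
  unfolding shilov_boundary_def
proof (rule Greatest_equality)
  show "boundary_ideal U {0}"
    by (rule boundary_ideal_zero[OF assms(1)])
next
  fix J assume J: "boundary_ideal U J"
  then have "J = {0}"
    using assms(2) boundary_ideal_Int_eq_0[OF assms(1) J]
    by (simp add: trivial_intersection_property_def boundary_ideal_def)
  then show "J \<le> {0}"
    by simp
qed

lemma quotient_alg_zero_isomorphic: "quotient_alg A {0} \<cong>\<^sub>* op_alg A"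
proof -
  have "bij_betw the_elem ((\<lambda>a. {a}) ` A) A"
    by (rule bij_betw_byWitness[where f' = "\<lambda>a. {a}"]) auto
  then have "star_isomorphism (quotient_alg A {0}) (op_alg A) the_elem"
    by (auto simp: star_isomorphism_def quotient_alg_def op_alg_def quotient_map_zero set_plus_def)
  then show ?thesis
    by (auto simp: star_isomorphic_def)
qed

theorem proposition2p2:
  fixes U :: "'h::complex_hilbert operator set"
  assumes "closed_op_subspace U"
    and "unital_subspace U"
    and "trivial_intersection_property U"
  shows "cstar_envelope U \<cong>\<^sub>* op_alg (cstar_gen U)"
  unfolding cstar_envelope_def shilov_boundary_eq_zero[OF assms(1,3)]
  by (rule quotient_alg_zero_isomorphic)

end
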